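(* Every Menger $K$-analytic space is Hurewicz.
   Context: All spaces are completely regular. A space is $K$-analytic if it is a continuous image of a Lindelöf Čech-complete space. $X$ is Menger if for every sequence $(\mathcal{U}_n)_{n<\omega}$ of open covers there are finite $\mathcal{V}_n\subseteq\mathcal{U}_n$ with $\bigcup_n\mathcal{V}_n$ covering $X$. $X$ is Hurewicz if for every sequence $(\mathcal{U}_n)_{n<\omega}$ of open covers there are finite $\mathcal{V}_n\subseteq\mathcal{U}_n$ such that every point of $X$ belongs to $\bigcup\mathcal{V}_n$ for all but finitely many $n$. *)

theory Defs
  imports "HOL-Analysis.Analysis"
begin

text \<open>Cech-complete: X is (homeomorphic to) a dense G-delta subspace of a compact Hausdorff
  space, i.e. X is G-delta in some compactification of X. The compactification is taken with
  carrier type 'a set set, which is large enough to contain the Stone-Cech compactification.\<close>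
definition cech_complete :: "'a topology \<Rightarrow> bool" where
  "cech_complete X \<longleftrightarrow> completely_regular_space X \<and>
     (\<exists>(K :: 'a set set topology) e. compact_space K \<and> Hausdorff_space K \<and>
        embedding_map X K e \<and> K closure_of (e ` topspace X) = topspace K \<and>
        gdelta_in K (e ` topspace X))"

definition open_cover :: "'a topology \<Rightarrow> 'a set set \<Rightarrow> bool" where
  "open_cover X \<U> \<longleftrightarrow> (\<forall>U\<in>\<U>. openin X U) \<and> topspace X \<subseteq> \<Union>\<U>"

definition menger_space :: "'a topology \<Rightarrow> bool" where
  "menger_space X \<longleftrightarrow>
     (\<forall>\<U> :: nat \<Rightarrow> 'a set set. (\<forall>n. open_cover X (\<U> n)) \<longrightarrow>
        (\<exists>\<V>. (\<forall>n. finite (\<V> n) \<and> \<V> n \<subseteq> \<U> n) \<and> topspace X \<subseteq> (\<Union>n. \<Union>(\<V> n))))"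

definition hurewicz_space :: "'a topology \<Rightarrow> bool" where
  "hurewicz_space X \<longleftrightarrow>
     (\<forall>\<U> :: nat \<Rightarrow> 'a set set. (\<forall>n. open_cover X (\<U> n)) \<longrightarrow>
        (\<exists>\<V>. (\<forall>n. finite (\<V> n) \<and> \<V> n \<subseteq> \<U> n) \<and>
             (\<forall>x\<in>topspace X. \<exists>N. \<forall>n\<ge>N. x \<in> \<Union>(\<V> n))))"

end

theory Submission
  imports Defs
begin

text \<open>Write the open covers of X as increasing countable families G n k and call a subset of X
  bounded if a single choice h satisfies x \<in> G n (h n) for almost all n, simultaneously for all
  its points x. Bounded sets form a sigma-ideal. If A is unbounded, then for some n all the sets
  A - G n k are unbounded, and these sets eventually miss a neighbourhood of each point. If X is
  unbounded, iterating this together with the countable closed covers of Y provided by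
  Cech-completeness yields a tree of closed subsets of Y, branching over the natural numbers, whose
  images form a locally finite family at each level and all of whose branches have a common point.
  The Menger property applied to the open sets that meet only finitely many members of a level
  produces a branch whose common point is missed, a contradiction. (This is Hurewicz's closed copy
  of the irrationals, without the need for a metric.)\<close>

section \<open>Finite subfamilies of covers and complete closed covers\<close>

text \<open>Enumerate a countable subcover and keep the members of index at most \<open>k\<close>.
  Monotonicity later lets a larger bound serve wherever a smaller one does.\<close>

lemma Lindelof_space_increasing_finite:
  assumes "Lindelof_space X" "open_cover X \<U>"
  obtains F :: "nat \<Rightarrow> 'a set set"
  where "\<And>k. finite (F k)" "\<And>k. F k \<subseteq> \<U>" "mono F" "topspace X \<subseteq> (\<Union>k. \<Union>(F k))"
proof -
  obtain \<V> where \<V>: "countable \<V>" "\<V> \<subseteq> \<U>" "topspace X \<subseteq> \<Union>\<V>"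
    using assms unfolding Lindelof_space_alt open_cover_def by meson
  define F where "F k = {U \<in> \<V>. to_nat_on \<V> U \<le> k}" for k
  have "finite (F k)" for k
  proof (rule inj_on_finite)
    show "inj_on (to_nat_on \<V>) (F k)"
      using inj_on_to_nat_on[OF \<V>(1)] by (rule inj_on_subset) (auto simp: F_def)
    show "to_nat_on \<V> ` F k \<subseteq> {..k}"
      by (auto simp: F_def)
  qed auto
  moreover have "mono F"
    by (force simp: F_def mono_def)
  moreover have "F k \<subseteq> \<U>" for k
    using \<V>(2) by (auto simp: F_def)
  moreover have "topspace X \<subseteq> (\<Union>k. \<Union>(F k))"
    using \<V>(3) by (force simp: F_def)
  ultimately show ?thesis
    using that by blast
qed

text \<open>Frolik's internal form of Cech-completeness, along the branches s.\<close>
definition complete_closed_covers :: "'b topology \<Rightarrow> (nat \<Rightarrow> nat \<Rightarrow> 'b set) \<Rightarrow> bool" where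
  "complete_closed_covers Y C \<longleftrightarrow>
     (\<forall>n k. closedin Y (C n k)) \<and> (\<forall>n. topspace Y \<subseteq> (\<Union>k. C n k)) \<and>
     (\<forall>D s. (\<forall>m. closedin Y (D m)) \<longrightarrow> (\<forall>m. D m \<noteq> {}) \<longrightarrow> decseq D \<longrightarrow>
        (\<forall>m. D (Suc m) \<subseteq> C m (s m)) \<longrightarrow> (\<Inter>m. D m) \<noteq> {})"

text \<open>Each \<open>C n k\<close> is the closure of a finite union of open sets whose images
  have closures in \<open>K\<close> inside \<open>W n\<close>. Compactness gives a common point of
  the closures of the images of the \<open>D m\<close>; it lies in every \<open>W n\<close>, hence
  in the copy of \<open>Y\<close>.\<close>

lemma cech_complete_Lindelof_closed_covers:
  fixes Y :: "'b topology"
  assumes "Lindelof_space Y" "cech_complete Y"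
  obtains C where "complete_closed_covers Y C"
proof -
  obtain K :: "'b set set topology" and e where K: "compact_space K" "Hausdorff_space K"
    and e: "embedding_map Y K e" and gd: "gdelta_in K (e ` topspace Y)"
    using assms(2) unfolding cech_complete_def by blast
  obtain W where "(\<forall>n. openin K (W n)) \<and> (\<forall>n. W (Suc n) \<subseteq> W n) \<and> \<Inter>(range W) = e ` topspace Y"
    using gd unfolding gdelta_in_descending ..
  then have W: "\<And>n. openin K (W n)" "\<Inter>(range W) = e ` topspace Y"
    by simp_all
  have hom: "homeomorphic_map Y (subtopology K (e ` topspace Y)) e"
    using e by (simp add: embedding_map_def)
  have cont: "continuous_map Y K e"
    using hom continuous_map_in_subtopology homeomorphic_imp_continuous_map by blast
  have nb: "neighbourhood_base_of (closedin K) K"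
    using K by (simp add: neighbourhood_base_of_closedin compact_Hausdorff_imp_regular_space)
  define \<U> where "\<U> n = {U. openin Y U \<and> K closure_of (e ` U) \<subseteq> W n}" for n
  have "open_cover Y (\<U> n)" for n
    unfolding open_cover_def
  proof (intro conjI ballI subsetI)
    fix y assume y: "y \<in> topspace Y"
    then have "e y \<in> W n"
      using W(2) by auto
    then obtain U V where UV: "openin K U" "closedin K V" "e y \<in> U" "U \<subseteq> V" "V \<subseteq> W n"
      using nb W(1) unfolding neighbourhood_base_of by meson
    let ?O = "{x \<in> topspace Y. e x \<in> U}"
    have "openin Y ?O"
      using cont UV(1) by (rule openin_continuous_map_preimage)
    moreover have "K closure_of (e ` ?O) \<subseteq> V"
      using UV by (intro closure_of_minimal) auto
    ultimately show "y \<in> \<Union>(\<U> n)"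
      using UV y by (auto simp: \<U>_def)
  qed (auto simp: \<U>_def)
  then have "\<exists>F. (\<forall>k. finite (F k) \<and> F k \<subseteq> \<U> n) \<and> topspace Y \<subseteq> (\<Union>k::nat. \<Union>(F k))" for n
    using Lindelof_space_increasing_finite[OF assms(1)] by metis
  then obtain F where F: "\<And>n k. finite (F n k)" "\<And>n k. F n k \<subseteq> \<U> n"
    "\<And>n. topspace Y \<subseteq> (\<Union>k::nat. \<Union>(F n k))"
    by metis
  \<comment> \<open>Finiteness of \<open>F n k\<close> matters here: closure commutes with finite
    unions.\<close>
  have FW: "K closure_of (e ` \<Union>(F n k)) \<subseteq> W n" for n k
  proof -
    have "K closure_of (e ` \<Union>(F n k)) = (\<Union>U\<in>F n k. K closure_of (e ` U))"
      using F(1) by (simp add: image_Union closure_of_Union)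
    then show ?thesis
      using F(2)[of n k] by (auto simp: \<U>_def)
  qed
  define C where "C n k = Y closure_of \<Union>(F n k)" for n k
  have "complete_closed_covers Y C"
    unfolding complete_closed_covers_def
  proof (intro conjI allI impI)
    show "closedin Y (C n k)" for n k
      by (simp add: C_def)
    show "topspace Y \<subseteq> (\<Union>k. C n k)" for n
    proof
      fix y assume "y \<in> topspace Y"
      then obtain k where k: "y \<in> \<Union>(F n k)"
        using F(3) by blast
      have "\<Union>(F n k) \<subseteq> topspace Y"
        using F(2)[of n k] openin_subset by (force simp: \<U>_def)
      then show "y \<in> (\<Union>k. C n k)"
        using k closure_of_subset unfolding C_def by blast
    qed
    fix D s
    assume "\<forall>m. closedin Y (D m)" "\<forall>m. D m \<noteq> {}" "decseq D" "\<forall>m. D (Suc m) \<subseteq> C m (s m)"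
    then have D: "\<And>m. closedin Y (D m)" "\<And>m. D m \<noteq> {}" "decseq D"
      "\<And>m. D (Suc m) \<subseteq> C m (s m)"
      by auto
    have Dsub: "D m \<subseteq> topspace Y" for m
      using D(1) by (rule closedin_subset)
    define E where "E m = K closure_of (e ` D m)" for m
    have "e ` D m \<subseteq> topspace K" for m
      using cont Dsub by (auto simp: continuous_map_def)
    then have "e ` D m \<subseteq> E m" for m
      by (simp add: E_def closure_of_subset)
    then have "E m \<noteq> {}" for m
      using D(2) by blast
    moreover have "decseq E"
      using D(3) by (auto simp: decseq_def E_def intro!: closure_of_mono image_mono)
    moreover have "closedin K (E m)" for m
      by (simp add: E_def)
    ultimately have "(\<Inter>m. E m) \<noteq> {}"
      using compact_space_imp_nest[OF K(1)] by blast
    then obtain z where z: "\<And>m. z \<in> E m"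
      by blast
    have "z \<in> W m" for m
    proof -
      have "e ` D (Suc m) \<subseteq> K closure_of (e ` \<Union>(F m (s m)))"
        using D(4)[of m] continuous_map_image_closure_subset[OF cont] unfolding C_def by blast
      then have "E (Suc m) \<subseteq> K closure_of (e ` \<Union>(F m (s m)))"
        unfolding E_def by (rule closure_of_minimal) simp
      then show ?thesis
        using z FW by blast
    qed
    then obtain y where y: "y \<in> topspace Y" "z = e y"
      using W(2) by blast
    \<comment> \<open>Since \<open>e\<close> is a homeomorphism onto its image, the image of the
      closed set \<open>D m\<close> is relatively closed, so it is the whole trace of
      \<open>E m\<close> on the copy of \<open>Y\<close>.\<close>
    have "y \<in> D m" for m
    proof -
      have "z \<in> subtopology K (e ` topspace Y) closure_of (e ` D m)"
        using z[of m] y Dsub[of m]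
        by (simp add: closure_of_subtopology E_def image_mono inf_absorb2)
      then have "z \<in> e ` D m"
        using homeomorphic_map_closure_of[OF hom Dsub[of m]] D(1)[of m]
        by (simp add: closure_of_closedin)
      then show ?thesis
        using y Dsub[of m] homeomorphic_imp_injective_map[OF hom] by (auto dest: inj_onD)
    qed
    then show "(\<Inter>m. D m) \<noteq> {}"
      by blast
  qed
  then show ?thesis ..
qed

section \<open>The sigma-ideal of bounded sets\<close>

definition bounded_along :: "(nat \<Rightarrow> nat \<Rightarrow> 'a set) \<Rightarrow> 'a set \<Rightarrow> bool" where
  "bounded_along G A \<longleftrightarrow> (\<exists>h. \<forall>x\<in>A. \<forall>\<^sub>F n in sequentially. x \<in> G n (h n))"

lemma bounded_along_subset: "bounded_along G B \<Longrightarrow> A \<subseteq> B \<Longrightarrow> bounded_along G A"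
  unfolding bounded_along_def by blast

text \<open>Diagonal domination: \<open>H n\<close> is at least \<open>h i n\<close> as soon as
  \<open>n \<ge> i\<close>.\<close>

lemma bounded_along_UN:
  fixes A :: "nat \<Rightarrow> 'a set"
  assumes G: "\<And>n. mono (G n)" and A: "\<And>i. bounded_along G (A i)"
  shows "bounded_along G (\<Union>i. A i)"
proof -
  obtain h where h: "\<And>i x. x \<in> A i \<Longrightarrow> \<forall>\<^sub>F n in sequentially. x \<in> G n (h i n)"
    using A unfolding bounded_along_def by metis
  define H where "H n = (\<Sum>i\<le>n. h i n)" for n
  have "\<forall>\<^sub>F n in sequentially. x \<in> G n (H n)" if x: "x \<in> A i" for x i
    using h[OF x] eventually_ge_at_top[of i]
  proof eventually_elim
    case (elim n)
    then have "h i n \<le> H n"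
      unfolding H_def by (intro member_le_sum) auto
    then show ?case
      using elim G[of n] by (auto dest: monoD)
  qed
  then show ?thesis
    unfolding bounded_along_def by blast
qed

text \<open>Otherwise some \<open>h\<close> makes every \<open>A - G n (h n)\<close> bounded. These
  sets together with the intersection of all \<open>G n (h n)\<close>, which \<open>h\<close> itself
  bounds, cover \<open>A\<close>.\<close>

lemma unbounded_along_diff:
  assumes G: "\<And>n. mono (G n)" and A: "\<not> bounded_along G A"
  obtains n where "\<And>j. \<not> bounded_along G (A - G n j)"
proof (rule ccontr)
  assume "\<not> thesis"
  then have "\<forall>n. \<exists>j. bounded_along G (A - G n j)"
    using that by blast
  then obtain h where h: "\<And>n. bounded_along G (A - G n (h n))"
    by metis
  define B where "B i = (case i of 0 \<Rightarrow> (\<Inter>n. G n (h n)) | Suc n \<Rightarrow> A - G n (h n))" for i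
  have "bounded_along G (\<Inter>n. G n (h n))"
    unfolding bounded_along_def by (rule exI[of _ h]) auto
  then have "bounded_along G (B i)" for i
    using h by (auto simp: B_def split: nat.split)
  then have "bounded_along G (\<Union>i. B i)"
    by (intro bounded_along_UN G)
  moreover have "A \<subseteq> (\<Union>i. B i)"
  proof
    fix x assume "x \<in> A"
    then have "x \<in> B 0 \<or> (\<exists>n. x \<in> B (Suc n))"
      by (auto simp: B_def)
    then show "x \<in> (\<Union>i. B i)"
      by blast
  qed
  ultimately show False
    using A bounded_along_subset by blast
qed

section \<open>The tree of closed sets\<close>

text \<open>Local finiteness is established in \<open>X\<close>, where the Menger property applies;
  common points of branches are found in \<open>Y\<close>, where the closed covers live, and
  \<open>f\<close> carries them to \<open>X\<close>.\<close>

lemma menger_bounded_along: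
  fixes G :: "nat \<Rightarrow> nat \<Rightarrow> 'a set"
  assumes complete: "complete_closed_covers Y C"
    and f: "continuous_map Y X f" "f ` topspace Y = topspace X"
    and X: "menger_space X"
    and G: "\<And>n k. openin X (G n k)" "\<And>n. mono (G n)" "\<And>n. topspace X \<subseteq> (\<Union>k. G n k)"
  shows "bounded_along G (topspace X)"
proof (rule ccontr)
  assume unb: "\<not> bounded_along G (topspace X)"
  have C: "\<And>n k. closedin Y (C n k)" "\<And>n. topspace Y \<subseteq> (\<Union>k. C n k)"
    using complete unfolding complete_closed_covers_def by auto
  note nest = complete[unfolded complete_closed_covers_def, THEN conjunct2, THEN conjunct2, rule_format]
  define P where "P n j = {y \<in> topspace Y. f y \<notin> G n j}" for n j
  have P: "closedin Y (P n j)" for n j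
  proof -
    have "closedin Y {y \<in> topspace Y. f y \<in> topspace X - G n j}"
      using f(1) G(1) by (intro closedin_continuous_map_preimage) auto
    moreover have "{y \<in> topspace Y. f y \<in> topspace X - G n j} = P n j"
      using f(2) by (auto simp: P_def)
    ultimately show ?thesis
      by simp
  qed
  \<comment> \<open>Here \<open>n\<close> depends on \<open>D\<close> alone, so all children of a
    node avoid members of the same family \<open>G n\<close>. A suitable \<open>k\<close> exists
    because countably many bounded pieces have a bounded union.\<close>
  have "\<exists>n. \<forall>j. \<forall>m. \<exists>k. \<not> bounded_along G (f ` (D \<inter> C m k \<inter> P n j))"
    if D: "D \<subseteq> topspace Y" "\<not> bounded_along G (f ` D)" for D
  proof -
    obtain n where n: "\<And>j. \<not> bounded_along G (f ` D - G n j)"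
      using unbounded_along_diff[OF G(2) D(2)] by blast
    have "\<exists>k. \<not> bounded_along G (f ` (D \<inter> C m k \<inter> P n j))" for m j
    proof (rule ccontr)
      assume "\<not> ?thesis"
      then have "bounded_along G (\<Union>k. f ` (D \<inter> C m k \<inter> P n j))"
        by (intro bounded_along_UN G) auto
      moreover have "f ` D - G n j \<subseteq> (\<Union>k. f ` (D \<inter> C m k \<inter> P n j))"
        using C(2)[of m] D(1) by (fastforce simp: P_def)
      ultimately show False
        using n bounded_along_subset by blast
    qed
    then show ?thesis
      by blast
  qed
  then obtain \<nu> \<kappa> where step: "\<And>D j m. \<lbrakk>D \<subseteq> topspace Y; \<not> bounded_along G (f ` D)\<rbrakk>
      \<Longrightarrow> \<not> bounded_along G (f ` (D \<inter> C m (\<kappa> D j m) \<inter> P (\<nu> D) j))"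
    by metis
  \<comment> \<open>Nodes of the tree are lists in reverse order: the head is the most recent choice.\<close>
  define T where "T = rec_list (topspace Y) (\<lambda>j u D. D \<inter> C (length u) (\<kappa> D j (length u)) \<inter> P (\<nu> D) j)"
  have T_simps: "T [] = topspace Y"
    "T (j # u) = T u \<inter> C (length u) (\<kappa> (T u) j (length u)) \<inter> P (\<nu> (T u)) j" for j u
    by (simp_all add: T_def)
  have T_closed: "closedin Y (T u)" for u
    by (induction u) (auto simp: T_simps intro!: closedin_Int C P)
  have T_unb: "\<not> bounded_along G (f ` T u)" for u
  proof (induction u)
    case Nil
    then show ?case
      using unb f(2) by (simp add: T_simps)
  next
    case (Cons j u)
    then show ?case
      unfolding T_simps by (intro step closedin_subset[OF T_closed])
  qed
  have T_ne: "T u \<noteq> {}" for u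
    using T_unb[of u] by (auto simp: bounded_along_def)
  \<comment> \<open>Nodes are counted rather than their images, so finiteness limits the labels even
    if some images coincide.\<close>
  define meets where "meets m V = {u. length u = m \<and> V \<inter> f ` T u \<noteq> {}}" for m V
  have fin: "\<exists>V. openin X V \<and> x \<in> V \<and> finite (meets m V)" if x: "x \<in> topspace X" for x m
  proof (induction m)
    case 0
    have "meets 0 (topspace X) \<subseteq> {[]}"
      by (auto simp: meets_def)
    then show ?case
      using x finite_subset by blast
  next
    case (Suc m)
    then obtain V where V: "openin X V" "x \<in> V" "finite (meets m V)"
      by blast
    have "\<exists>k. x \<in> G n k" for n
      using G(3) x by blast
    then obtain k where k: "\<And>n. x \<in> G n (k n)"
      by metis
    \<comment> \<open>Only the finitely many parents in \<open>meets m V\<close> can have children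
      meeting \<open>V\<close>; for each parent \<open>u\<close>, one set
      \<open>G (\<nu> (T u))\<close> around \<open>x\<close> excludes all children with label at
      least \<open>k (\<nu> (T u))\<close>.\<close>
    define V' where "V' = V \<inter> (\<Inter>u\<in>meets m V. topspace X \<inter> G (\<nu> (T u)) (k (\<nu> (T u))))"
    have "openin X V'"
    proof (cases "meets m V = {}")
      case True
      then show ?thesis
        using V by (simp add: V'_def)
    next
      case False
      then show ?thesis
        unfolding V'_def using V G(1) by (intro openin_Int openin_INT2) auto
    qed
    moreover have "x \<in> V'"
      using V x k by (auto simp: V'_def)
    moreover have "finite (meets (Suc m) V')"
    proof (rule finite_subset)
      show "meets (Suc m) V' \<subseteq> (\<Union>u\<in>meets m V. (\<lambda>j. j # u) ` {..<k (\<nu> (T u))})"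
      proof
        fix w assume w: "w \<in> meets (Suc m) V'"
        then obtain j u where ju: "w = j # u" "length u = m"
          by (auto simp: meets_def length_Suc_conv)
        obtain y where y: "y \<in> T (j # u)" "f y \<in> V'"
          using w ju by (auto simp: meets_def)
        then have u: "u \<in> meets m V"
          using ju by (auto simp: meets_def V'_def T_simps)
        then have "f y \<in> G (\<nu> (T u)) (k (\<nu> (T u)))" "f y \<notin> G (\<nu> (T u)) j"
          using y unfolding V'_def T_simps P_def by blast+
        then have "j < k (\<nu> (T u))"
          using monoD[OF G(2)] by (metis linorder_not_less in_mono)
        then show "w \<in> (\<Union>u\<in>meets m V. (\<lambda>j. j # u) ` {..<k (\<nu> (T u))})"
          using u ju by blast
      qed
    qed (use V in auto)
    ultimately show ?case
      by blast
  qed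
  define \<W> where "\<W> m = {V. openin X V \<and> finite (meets (Suc m) V)}" for m
  have "\<forall>m. open_cover X (\<W> m)"
    using fin by (force simp: open_cover_def \<W>_def)
  then obtain \<V> where \<V>: "\<And>m. finite (\<V> m)" "\<And>m. \<V> m \<subseteq> \<W> m" "topspace X \<subseteq> (\<Union>m. \<Union>(\<V> m))"
    using X unfolding menger_space_def by metis
  \<comment> \<open>The head is the newest label. A label outside the finite set of heads works for
    all parents \<open>u\<close> at once, so the choice at level \<open>m\<close> ignores the
    earlier ones.\<close>
  have "\<exists>a. \<forall>u. a # u \<notin> (\<Union>V\<in>\<V> m. meets (Suc m) V)" for m
  proof -
    have "finite (hd ` (\<Union>V\<in>\<V> m. meets (Suc m) V))"
      using \<V>(1) \<V>(2)[of m] by (intro finite_imageI finite_UN_I) (auto simp: \<W>_def)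
    then obtain a where "a \<notin> hd ` (\<Union>V\<in>\<V> m. meets (Suc m) V)"
      using ex_new_if_finite infinite_UNIV_nat by blast
    then show ?thesis
      by (metis image_eqI list.sel(1))
  qed
  then obtain \<alpha> where \<alpha>: "\<And>m u. \<alpha> m # u \<notin> (\<Union>V\<in>\<V> m. meets (Suc m) V)"
    by metis
  define b where "b = rec_nat [] (\<lambda>m u. \<alpha> m # u)"
  have b: "b 0 = []" "b (Suc m) = \<alpha> m # b m" for m
    by (simp_all add: b_def)
  have len: "length (b m) = m" for m
    by (induction m) (auto simp: b)
  have "(\<Inter>m. T (b m)) \<noteq> {}"
  proof (rule nest)
    show "decseq (\<lambda>m. T (b m))"
      by (rule decseq_SucI) (auto simp: b T_simps)
    show "T (b (Suc m)) \<subseteq> C m (\<kappa> (T (b m)) (\<alpha> m) m)" for m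
      by (auto simp: b T_simps len)
  qed (use T_closed T_ne in auto)
  then obtain y where y: "\<And>m. y \<in> T (b m)"
    by blast
  then have "f y \<in> topspace X"
    using T_closed closedin_subset f(2) by blast
  then obtain m V where V: "V \<in> \<V> m" "f y \<in> V"
    using \<V>(3) by blast
  \<comment> \<open>The point \<open>f y\<close> lies both in \<open>V\<close> and in the image of
    the node \<open>b (Suc m)\<close>, which was chosen to miss every member of
    \<open>\<V> m\<close>.\<close>
  then have "b (Suc m) \<in> meets (Suc m) V"
    using y[of "Suc m"] len by (auto simp: meets_def)
  then show False
    using \<alpha> V(1) b(2) by auto
qed

text \<open>With \<open>G n k\<close> the union of the finite family \<open>F n k\<close>, a bound
  \<open>h\<close> for the whole space gives the Hurewicz selection
  \<open>F n (h n)\<close>.\<close>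

theorem theorem3p4:
  fixes X :: "'a topology" and Y :: "'b topology" and f :: "'b \<Rightarrow> 'a"
  assumes "completely_regular_space X"
    and "Lindelof_space Y" and "cech_complete Y"
    and "continuous_map Y X f" and "f ` topspace Y = topspace X"
    and "menger_space X"
  shows "hurewicz_space X"
  unfolding hurewicz_space_def
proof (intro allI impI)
  fix \<U> :: "nat \<Rightarrow> 'a set set"
  assume \<U>: "\<forall>n. open_cover X (\<U> n)"
  have "Lindelof_space X"
    using assms(2,4,5) by (rule Lindelof_space_continuous_map_image)
  then have "\<exists>F. (\<forall>k. finite (F k) \<and> F k \<subseteq> \<U> n) \<and> mono F \<and> topspace X \<subseteq> (\<Union>k::nat. \<Union>(F k))" for n
    using Lindelof_space_increasing_finite \<U> by metis
  then obtain F where F: "\<And>n k. finite (F n k)" "\<And>n k. F n k \<subseteq> \<U> n" "\<And>n. mono (F n)"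
    "\<And>n. topspace X \<subseteq> (\<Union>k::nat. \<Union>(F n k))"
    by metis
  define G where "G n k = \<Union>(F n k)" for n k
  obtain C where "complete_closed_covers Y C"
    using cech_complete_Lindelof_closed_covers[OF assms(2,3)] by blast
  then have "bounded_along G (topspace X)"
  proof (rule menger_bounded_along[OF _ assms(4-6)])
    show "openin X (G n k)" for n k
      unfolding G_def using \<U> F(2)[of n k] by (intro openin_Union) (auto simp: open_cover_def)
    show "mono (G n)" for n
      unfolding G_def by (intro monoI Union_mono monoD[OF F(3)])
    show "topspace X \<subseteq> (\<Union>k. G n k)" for n
      using F(4) by (simp add: G_def)
  qed
  then obtain h where "\<forall>x\<in>topspace X. \<forall>\<^sub>F n in sequentially. x \<in> \<Union>(F n (h n))"
    unfolding bounded_along_def G_def ..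
  then show "\<exists>\<V>. (\<forall>n. finite (\<V> n) \<and> \<V> n \<subseteq> \<U> n) \<and>
      (\<forall>x\<in>topspace X. \<exists>N. \<forall>n\<ge>N. x \<in> \<Union>(\<V> n))"
    using F(1,2) by (intro exI[of _ "\<lambda>n. F n (h n)"]) (simp add: eventually_sequentially)
qed

end
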